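(* Let $\mathsf{MonKey}$ be an injective map from the monomials of $\mathbb{F}_p[x_1,\dots,x_n]$ to a totally ordered set of keys such that $u\prec v$ implies $\mathsf{MonKey}(u)<\mathsf{MonKey}(v)$ for all monomials $u,v$. Fix the batch inputs (the current basis $G$ and the batch specification $(\mathcal{U},\mathcal{C},\mathsf{Adm})$), and assume that the row-selection stage of the FBSP algorithm described in the context always outputs the same $\mathcal{R}=\{(t_i,g_{k_i})\}_{i=1}^r$ with a deterministic ordering of its rows. Then the FBSP algorithm produces a unique dictionary $\mathcal{T}$ and a unique sparse plan $\Pi=(\texttt{row\_ptr},\texttt{col\_ind},\texttt{val},\texttt{dict\_keys},\texttt{row\_meta})$; that is, the outputs $\mathcal{T}$ and $\Pi$ do not depend on thread scheduling (the order or interleaving in which the iterations of the parallel loops are executed).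
   Context: Setting: $p$ is prime, $\mathbb{F}_p[x_1,\dots,x_n]$ carries a fixed term order $\prec$, and $G$ is a finite set of polynomials. $\operatorname{supp}(f)$ is the set of monomials occurring in $f$ with nonzero coefficient. A batch specification is a triple $(\mathcal{U},\mathcal{C},\mathsf{Adm})$ consisting of a finite set $\mathcal{U}$ of targets, a finite set $\mathcal{C}$ of candidate reducers, and an admissibility predicate $\mathsf{Adm}$. For each $g_k\in G$, its monomials in $\prec$-order, largest first, are written $m_{k,0}\succ m_{k,1}\succ\cdots$ with nonzero coefficients $c_{k,0},c_{k,1},\dots\in\mathbb{F}_p$. FBSP algorithm. (0) Row selection: from the batch specification construct a list $\mathcal{R}=\{(t_i,g_{k_i})\}_{i=1}^r$ of admissible pairs, with $t_i$ a monomial and $g_{k_i}\in G$. (1) Count: in parallel for $i=1,\dots,r$, compute $\ell_i=|\operatorname{supp}(t_i g_{k_i})|$; then compute $\texttt{row\_ptr}[1]=0$, $\texttt{row\_ptr}[i+1]=\texttt{row\_ptr}[i]+\ell_i$; put $M=\sum_i\ell_i$. Allocate arrays $\texttt{row\_key}$, $\texttt{row\_val}$, indexed by $0,\dots,M-1$. (2) Fill: in parallel for $i=1,\dots,r$, with $s=\texttt{row\_ptr}[i]$, for $j=0,\dots,\ell_i-1$ write $\texttt{row\_key}[s+j]\leftarrow\mathsf{MonKey}(t_i\cdot m_{k_i,j})$ and $\texttt{row\_val}[s+j]\leftarrow c_{k_i,j}$. (3) Dictionary: sort (a copy of) the array $\texttt{row\_key}$ by key, largest first, and remove duplicates, obtaining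 the array $\texttt{dict\_keys}$ of length $N$; this encodes the dictionary $\mathcal{T}=\{m_1\succ\cdots\succ m_N\}$, where $\mathsf{MonKey}(m_j)$ is the $j$-th entry of $\texttt{dict\_keys}$. (4) Row assembly: allocate $\texttt{col\_ind}$, indexed by $0,\dots,M-1$; in parallel for $i=1,\dots,r$, for each position $q$ with $\texttt{row\_ptr}[i]\le q<\texttt{row\_ptr}[i+1]$, set $\texttt{col\_ind}[q]$ to the index $j\in\{1,\dots,N\}$ at which $\texttt{row\_key}[q]$ occurs in $\texttt{dict\_keys}$. (5) Output $\mathcal{T}$, $\mathcal{R}$ and $\Pi=(\texttt{row\_ptr},\texttt{col\_ind},\texttt{val},\texttt{dict\_keys},\texttt{row\_meta})$, where $\texttt{val}=\texttt{row\_val}$ and $\texttt{row\_meta}$ stores $(t_i,k_i)$ for each row $i$. Each numbered step is completed before the next begins; within a parallel loop the iterations may be executed in any order and with any interleaving. *)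

theory Defs
  imports
    "HOL-Library.Poly_Mapping"
    "Berlekamp_Zassenhaus.Finite_Field"
begin

section \<open>Polynomials over a prime field\<close>

text \<open>A monomial is its exponent vector, so the product of monomials is addition of exponent
  vectors and the monomial 1 is 0. The variables are the elements of a finite type \<open>'v\<close>
  (\<open>n = CARD('v)\<close>), and \<open>'p mod_ring\<close> with \<open>'p :: prime_card\<close> is the field with \<open>p = CARD('p)\<close>
  elements. The support of \<open>f\<close> is \<open>Poly_Mapping.keys f\<close>.\<close>

type_synonym 'v mon = "'v \<Rightarrow>\<^sub>0 nat"
type_synonym ('v, 'p) fpoly = "'v mon \<Rightarrow>\<^sub>0 'p mod_ring"

definition term_order :: "('v mon \<Rightarrow> 'v mon \<Rightarrow> bool) \<Rightarrow> bool" where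
  "term_order prec \<longleftrightarrow>
     irreflp prec \<and> transp prec \<and> totalp prec \<and>
     (\<forall>u v w. prec u v \<longrightarrow> prec (u + w) (v + w)) \<and>
     (\<forall>u. u \<noteq> 0 \<longrightarrow> prec 0 u)"

text \<open>The list \<open>m\<^sub>0 \<succ> m\<^sub>1 \<succ> \<dots>\<close> of the monomials of a polynomial.\<close>

definition desc_monomials :: "('v mon \<Rightarrow> 'v mon \<Rightarrow> bool) \<Rightarrow> ('v, 'p::prime_card) fpoly \<Rightarrow> 'v mon list" where
  "desc_monomials prec g = (THE ms. sorted_wrt (\<lambda>u v. prec v u) ms \<and> set ms = Poly_Mapping.keys g)"


section \<open>Batch inputs\<close>

text \<open>The basis is a list \<open>gs\<close> without repetitions, with \<open>gs ! k\<close> in the role of \<open>g\<^sub>k\<close>. A row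
  \<open>(t, k)\<close> stands for the pair \<open>(t, g\<^sub>k)\<close>. Targets and candidate reducers may be of any type;
  admissibility is a property of the pairs \<open>(t, g)\<close> that can be selected as rows.\<close>

type_synonym 'v row = "'v mon \<times> nat"

record ('u, 'c, 'v, 'p) batch_spec =
  targets :: "'u set"
  candidates :: "'c set"
  Adm :: "'v mon \<Rightarrow> ('v, 'p) fpoly \<Rightarrow> bool"

definition admissible_rows ::
  "('v, 'p::prime_card) fpoly list \<Rightarrow> ('u, 'c, 'v, 'p) batch_spec \<Rightarrow> 'v row list \<Rightarrow> bool" where
  "admissible_rows gs B R \<longleftrightarrow> (\<forall>(t, k) \<in> set R. k < length gs \<and> Adm B t (gs ! k))"


section \<open>Parallel loops\<close>

text \<open>An iteration of a parallel loop is a thread over a shared memory of type \<open>'m\<close>. One atomic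
  step is either a read, on whose result the rest of the thread may depend, or a write.\<close>

datatype 'm thread =
    Done
  | Read "'m \<Rightarrow> 'm thread"
  | Write "'m \<Rightarrow> 'm" "'m thread"

inductive thread_step :: "'m thread \<times> 'm \<Rightarrow> 'm thread \<times> 'm \<Rightarrow> bool" where
  "thread_step (Read c, \<sigma>) (c \<sigma>, \<sigma>)"
| "thread_step (Write f th, \<sigma>) (th, f \<sigma>)"

inductive par_step :: "'m thread list \<times> 'm \<Rightarrow> 'm thread list \<times> 'm \<Rightarrow> bool" where
  "i < length ths \<Longrightarrow> thread_step (ths ! i, \<sigma>) (th', \<sigma>') \<Longrightarrow>
     par_step (ths, \<sigma>) (ths[i := th'], \<sigma>')"

text \<open>\<open>par_loop ths \<sigma> \<sigma>'\<close>: some interleaving of all the iterations \<open>ths\<close>, run to completion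
  from memory \<open>\<sigma>\<close>, ends in memory \<open>\<sigma>'\<close>.\<close>

definition par_loop :: "'m thread list \<Rightarrow> 'm \<Rightarrow> 'm \<Rightarrow> bool" where
  "par_loop ths \<sigma> \<sigma>' \<longleftrightarrow> par_step\<^sup>*\<^sup>* (ths, \<sigma>) (replicate (length ths) Done, \<sigma>')"

text \<open>Under every schedule a parallel loop runs to completion: there is no infinite interleaving,
  and an interleaving can be continued until all its threads are done. Hence \<open>par_loop\<close>
  leaves out no behaviour.\<close>

lemma thread_step_wf: "wf {(th', th). \<exists>\<sigma> \<sigma>'. thread_step (th, \<sigma>) (th', \<sigma>')}"
proof (rule wfUNIVI)
  fix P :: "'a thread \<Rightarrow> bool" and th
  assume *: "\<forall>x. (\<forall>y. (y, x) \<in> {(th', th). \<exists>\<sigma> \<sigma>'. thread_step (th, \<sigma>) (th', \<sigma>')} \<longrightarrow> P y) \<longrightarrow> P x"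
  then have step: "P x" if "\<And>y \<sigma> \<sigma>'. thread_step (x, \<sigma>) (y, \<sigma>') \<Longrightarrow> P y" for x
    using that by blast
  show "P th"
  proof (induction th)
    case Done
    show ?case by (rule step) (auto elim: thread_step.cases)
  next
    case (Read c)
    show ?case
    proof (rule step)
      fix y \<sigma> \<sigma>' assume "thread_step (Read c, \<sigma>) (y, \<sigma>')"
      then have "y = c \<sigma>" by (auto elim: thread_step.cases)
      then show "P y" using Read by simp
    qed
  next
    case (Write f th)
    show ?case
    proof (rule step)
      fix y \<sigma> \<sigma>' assume "thread_step (Write f th, \<sigma>) (y, \<sigma>')"
      then have "y = th" by (auto elim: thread_step.cases)
      then show "P y" using Write by simp
    qed
  qed
qed

lemma par_step_wf: "wf {(c', c). par_step c c'}"
proof (rule wf_subset)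
  let ?r = "{(th', th :: 'a thread). \<exists>\<sigma> \<sigma>'. thread_step (th, \<sigma>) (th', \<sigma>')}"
  show "wf (inv_image (listrel1 ?r) fst)"
    by (rule wf_inv_image, subst wf_listrel1_iff, rule thread_step_wf)
  show "{(c', c). par_step c c'} \<subseteq> inv_image (listrel1 ?r) fst"
  proof clarify
    fix ths' ths :: "'a thread list" and \<sigma>' \<sigma>
    assume "par_step (ths, \<sigma>) (ths', \<sigma>')"
    then obtain i th' where i: "i < length ths" "thread_step (ths ! i, \<sigma>) (th', \<sigma>')"
      and "ths' = ths[i := th']"
      by (cases rule: par_step.cases) auto
    then have split: "ths = take i ths @ ths ! i # drop (Suc i) ths"
      and split': "ths' = take i ths @ th' # drop (Suc i) ths"
      by (simp_all add: id_take_nth_drop upd_conv_take_nth_drop)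
    have "(th', ths ! i) \<in> ?r"
      using i by blast
    then have "(ths', ths) \<in> listrel1 ?r"
      using split' split by (rule listrel1I)
    then show "((ths', \<sigma>'), (ths, \<sigma>)) \<in> inv_image (listrel1 ?r) fst"
      by (simp only: in_inv_image fst_conv)
  qed
qed

lemma par_step_progress:
  assumes "ths \<noteq> replicate (length ths) Done"
  shows "\<exists>c'. par_step (ths, \<sigma>) c'"
proof -
  obtain i where i: "i < length ths" "ths ! i \<noteq> Done"
    using assms that by (auto simp: list_eq_iff_nth_eq)
  then have "\<exists>th' \<sigma>'. thread_step (ths ! i, \<sigma>) (th', \<sigma>')"
    by (cases "ths ! i") (auto intro: thread_step.intros)
  with i show ?thesis
    by (blast intro: par_step.intros)
qed


section \<open>The FBSP algorithm\<close>

text \<open>Rows are numbered from 0, so entry \<open>i\<close> of \<open>ell\<close> and of \<open>row_ptr\<close> belongs to row number \<open>i + 1\<close>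
  of the 1-based presentation. The entries of \<open>col_ind\<close>, on the other hand, are the
  indices \<open>1, \<dots>, N\<close>.\<close>

record ('k, 'p) fbsp_mem =
  ell :: "nat list"
  row_ptr :: "nat list"
  row_key :: "'k list"
  row_val :: "'p mod_ring list"
  dict_keys :: "'k list"
  col_ind :: "nat list"

definition count_row ::
  "('v, 'p::prime_card) fpoly list \<Rightarrow> 'v row list \<Rightarrow> nat \<Rightarrow> ('k, 'p) fbsp_mem thread" where
  "count_row gs R i =
     (let (t, k) = R ! i; l = card (Poly_Mapping.keys (Poly_Mapping.single t 1 * gs ! k))
      in Write (ell_update (\<lambda>a. a[i := l])) Done)"

text \<open>\<open>prefix_sums 0 [l\<^sub>1, \<dots>, l\<^sub>r]\<close> is the list \<open>[0, l\<^sub>1, l\<^sub>1 + l\<^sub>2, \<dots>]\<close> of length \<open>r + 1\<close>.\<close>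

primrec prefix_sums :: "nat \<Rightarrow> nat list \<Rightarrow> nat list" where
  "prefix_sums s [] = [s]"
| "prefix_sums s (l # ls) = s # prefix_sums (s + l) ls"

text \<open>\<open>fill_from \<dots> s j n\<close>: the iterations \<open>j, \<dots>, j + n - 1\<close> of the inner loop.\<close>

primrec fill_from ::
  "('v mon \<Rightarrow> 'v mon \<Rightarrow> bool) \<Rightarrow> ('v mon \<Rightarrow> 'k) \<Rightarrow> 'v mon \<Rightarrow> ('v, 'p::prime_card) fpoly \<Rightarrow>
   nat \<Rightarrow> nat \<Rightarrow> nat \<Rightarrow> ('k, 'p) fbsp_mem thread" where
  "fill_from prec MonKey t g s j 0 = Done"
| "fill_from prec MonKey t g s j (Suc n) =
     (let m = desc_monomials prec g ! j
      in Write (row_key_update (\<lambda>a. a[s + j := MonKey (t + m)]))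
           (Write (row_val_update (\<lambda>a. a[s + j := Poly_Mapping.lookup g m]))
             (fill_from prec MonKey t g s (Suc j) n)))"

definition fill_row ::
  "('v mon \<Rightarrow> 'v mon \<Rightarrow> bool) \<Rightarrow> ('v mon \<Rightarrow> 'k) \<Rightarrow> ('v, 'p::prime_card) fpoly list \<Rightarrow> 'v row list \<Rightarrow>
   nat \<Rightarrow> ('k, 'p) fbsp_mem thread" where
  "fill_row prec MonKey gs R i =
     (let (t, k) = R ! i
      in Read (\<lambda>\<sigma>. let s = row_ptr \<sigma> ! i
         in Read (\<lambda>\<sigma>. let l = ell \<sigma> ! i
         in fill_from prec MonKey t (gs ! k) s 0 l)))"

definition dict_index :: "'k list \<Rightarrow> 'k \<Rightarrow> nat" where
  "dict_index ds x = (THE j. j \<in> {1..length ds} \<and> ds ! (j - 1) = x)"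

primrec assemble_from :: "nat \<Rightarrow> nat \<Rightarrow> ('k, 'p) fbsp_mem thread" where
  "assemble_from q 0 = Done"
| "assemble_from q (Suc n) =
     Read (\<lambda>\<sigma>. let x = row_key \<sigma> ! q
     in Read (\<lambda>\<sigma>. let j = dict_index (dict_keys \<sigma>) x
     in Write (col_ind_update (\<lambda>a. a[q := j])) (assemble_from (Suc q) n)))"

definition assemble_row :: "nat \<Rightarrow> ('k, 'p) fbsp_mem thread" where
  "assemble_row i =
     Read (\<lambda>\<sigma>. let q = row_ptr \<sigma> ! i
     in Read (\<lambda>\<sigma>. let q' = row_ptr \<sigma> ! Suc i
     in assemble_from q (q' - q)))"

text \<open>\<open>(row_ptr, col_ind, val, dict_keys, row_meta)\<close>\<close>

type_synonym ('k, 'p, 'v) sparse_plan =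
  "nat list \<times> nat list \<times> 'p mod_ring list \<times> 'k list \<times> 'v row list"

text \<open>\<open>fbsp_run prec MonKey Sel gs B T R plan\<close>: some complete execution on the batch inputs \<open>gs\<close>
  and \<open>B\<close> outputs \<open>T\<close>, \<open>R\<close> and \<open>plan\<close>. Here \<open>Sel gs B\<close> is the set of possible outcomes of row
  selection. The initial memory is arbitrary and newly allocated arrays have arbitrary
  contents (\<open>ks\<close>, \<open>vs\<close>, \<open>cs\<close>). The dictionary \<open>T\<close> is the \<open>\<succ>\<close>-decreasing list of monomials that
  \<open>dict_keys\<close> encodes.\<close>

definition fbsp_run ::
  "('v mon \<Rightarrow> 'v mon \<Rightarrow> bool) \<Rightarrow> ('v mon \<Rightarrow> 'k::linorder) \<Rightarrow>
   (('v, 'p::prime_card) fpoly list \<Rightarrow> ('u, 'c, 'v, 'p) batch_spec \<Rightarrow> 'v row list set) \<Rightarrow>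
   ('v, 'p) fpoly list \<Rightarrow> ('u, 'c, 'v, 'p) batch_spec \<Rightarrow>
   'v mon list \<Rightarrow> 'v row list \<Rightarrow> ('k, 'p, 'v) sparse_plan \<Rightarrow> bool" where
  "fbsp_run prec MonKey Sel gs B T R plan \<longleftrightarrow>
     R \<in> Sel gs B \<and>
     (\<exists>\<sigma>\<^sub>0 \<sigma>\<^sub>1 \<sigma>\<^sub>2 \<sigma>\<^sub>3 \<sigma>\<^sub>4 \<sigma>\<^sub>5 ks vs cs M.
        length (ell \<sigma>\<^sub>0) = length R \<and>
        par_loop (map (count_row gs R) [0..<length R]) \<sigma>\<^sub>0 \<sigma>\<^sub>1 \<and>
        M = sum_list (ell \<sigma>\<^sub>1) \<and>
        length ks = M \<and> length vs = M \<and>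
        \<sigma>\<^sub>2 = \<sigma>\<^sub>1\<lparr>row_ptr := prefix_sums 0 (ell \<sigma>\<^sub>1), row_key := ks, row_val := vs\<rparr> \<and>
        par_loop (map (fill_row prec MonKey gs R) [0..<length R]) \<sigma>\<^sub>2 \<sigma>\<^sub>3 \<and>
        length cs = M \<and>
        \<sigma>\<^sub>4 = \<sigma>\<^sub>3\<lparr>dict_keys := remdups (rev (sort (row_key \<sigma>\<^sub>3))), col_ind := cs\<rparr> \<and>
        par_loop (map assemble_row [0..<length R]) \<sigma>\<^sub>4 \<sigma>\<^sub>5 \<and>
        sorted_wrt (\<lambda>u v. prec v u) T \<and> map MonKey T = dict_keys \<sigma>\<^sub>5 \<and>
        plan = (row_ptr \<sigma>\<^sub>5, col_ind \<sigma>\<^sub>5, row_val \<sigma>\<^sub>5, dict_keys \<sigma>\<^sub>5, R))"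

end

theory Submission
  imports Defs
begin

text \<open>In each parallel loop the threads read only memory fields that no thread of the loop writes,
  so the writes a thread will perform are known when the loop starts. Writes of different
  threads hit different array positions and hence commute, so every interleaving ends in the
  memory reached by running the threads one after the other. Every position of a newly allocated array is
  overwritten, so its initial contents leave no trace. Finally \<open>dict_keys\<close> is a strictly
  decreasing list of values of the strictly monotone \<open>MonKey\<close>, so it encodes exactly one
  decreasing list of monomials.\<close>

section \<open>Parallel loops with commuting writes\<close>

text \<open>\<open>straight I th fs\<close>: as long as the memory stays in \<open>I\<close>, the thread \<open>th\<close> performs
  exactly the writes \<open>fs\<close>, whatever the other threads do.\<close>

inductive straight :: "'m set \<Rightarrow> 'm thread \<Rightarrow> ('m \<Rightarrow> 'm) list \<Rightarrow> bool" for I where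
  Done: "straight I Done []"
| Read: "(\<And>\<sigma>. \<sigma> \<in> I \<Longrightarrow> c \<sigma> = th) \<Longrightarrow> straight I th fs \<Longrightarrow> straight I (Read c) fs"
| Write: "straight I th fs \<Longrightarrow> straight I (Write f th) (f # fs)"

lemma straight_Done_iff: "straight I Done fs \<longleftrightarrow> fs = []"
  by (auto elim: straight.cases intro: straight.Done)

abbreviation apply_all :: "('m \<Rightarrow> 'm) list \<Rightarrow> 'm \<Rightarrow> 'm" where
  "apply_all fs \<equiv> fold (\<lambda>f. f) fs"

lemma apply_all_commute:
  assumes "\<And>g x. g \<in> set fs \<Longrightarrow> f (g x) = g (f x)"
  shows "apply_all fs (f \<sigma>) = f (apply_all fs \<sigma>)"
  using assms
proof (induction fs arbitrary: \<sigma>)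
  case (Cons g fs)
  have "apply_all fs (g (f \<sigma>)) = apply_all fs (f (g \<sigma>))"
    using Cons.prems[of g \<sigma>] by simp
  also have "\<dots> = f (apply_all fs (g \<sigma>))"
    using Cons.prems by (intro Cons.IH) auto
  finally show ?case by simp
qed simp

text \<open>A pending write \<open>f\<close> of thread \<open>i\<close> may be carried out at once
  instead of in its sequential place: all that precedes it in \<open>concat fss\<close> comes from
  lists at smaller indices, whose writes commute with it. This handles a write step of an arbitrary
  interleaving.\<close>

lemma apply_all_concat_pull:
  assumes "i < length fss" and "fss ! i = f # fs"
    and "\<And>j g x. j < length fss \<Longrightarrow> j \<noteq> i \<Longrightarrow> g \<in> set (fss ! j) \<Longrightarrow> f (g x) = g (f x)"
  shows "apply_all (concat (fss[i := fs])) (f \<sigma>) = apply_all (concat fss) \<sigma>"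
proof -
  have comm: "f (g x) = g (f x)" if g: "g \<in> set (concat (take i fss))" for g x
  proof -
    obtain j where "j < length fss" "j < i" "g \<in> set (fss ! j)"
      using g by (auto simp: in_set_conv_nth) (metis nth_mem)
    then show ?thesis using assms(3) by blast
  qed
  have "concat fss = concat (take i fss @ (f # fs) # drop (Suc i) fss)"
    using assms(1,2) by (metis id_take_nth_drop)
  moreover have "concat (fss[i := fs]) = concat (take i fss @ fs # drop (Suc i) fss)"
    using assms(1) by (simp add: upd_conv_take_nth_drop)
  ultimately show ?thesis
    using apply_all_commute[of "concat (take i fss)" f \<sigma>, OF comm] by simp
qed

text \<open>Induction along the interleaving, with \<open>fss\<close> holding the writes still
  pending. A read changes neither the memory nor \<open>fss\<close>; a write takes the head off one
  list, and by commutation the sequential result from the new memory equals the old one. At the end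
  nothing is pending.\<close>

lemma par_steps_result:
  assumes "par_step\<^sup>*\<^sup>* (ths, \<sigma>) (replicate n Done, \<sigma>')"
    and "list_all2 (straight I) ths fss" and "\<sigma> \<in> I"
    and "\<And>f \<tau>. f \<in> set (concat fss) \<Longrightarrow> \<tau> \<in> I \<Longrightarrow> f \<tau> \<in> I"
    and "\<And>i j f g x. i < length fss \<Longrightarrow> j < length fss \<Longrightarrow> i \<noteq> j \<Longrightarrow> f \<in> set (fss ! i) \<Longrightarrow>
           g \<in> set (fss ! j) \<Longrightarrow> f (g x) = g (f x)"
  shows "\<sigma>' = apply_all (concat fss) \<sigma>"
  using assms
proof (induction "ths" \<sigma> arbitrary: fss rule: converse_rtranclp_induct2)
  case refl
  then have "set fss \<subseteq> {[]}"
    by (auto simp: list_all2_conv_all_nth in_set_conv_nth straight_Done_iff)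
  then have "concat fss = []"
    by auto
  then show ?case by (simp del: concat_eq_Nil_conv)
next
  case (step ths \<sigma> ths' \<sigma>1)
  note inv = step.prems(3) and comm = step.prems(4)
  obtain i th' where i: "i < length ths" "thread_step (ths ! i, \<sigma>) (th', \<sigma>1)" "ths' = ths[i := th']"
    using step.hyps(1) by (cases rule: par_step.cases) auto
  have len: "length ths = length fss" and i': "i < length fss"
    and str: "straight I (ths ! i) (fss ! i)"
    using i step.prems(1) by (auto simp: list_all2_conv_all_nth)
  from i(2) show ?case
  proof (cases rule: thread_step.cases)
    case (1 c)
    \<comment> \<open>Since \<open>\<sigma>\<close> lies in \<open>I\<close>, the read selects the
      one continuation fixed by the \<open>Read\<close> rule, so the same writes stay
      pending.\<close>
    have "straight I th' (fss ! i)"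
      using str 1 step.prems(2) by (auto elim: straight.cases)
    then have "list_all2 (straight I) ths' fss"
      using step.prems(1) i by (auto simp: list_all2_conv_all_nth nth_list_update)
    then have "\<sigma>' = apply_all (concat fss) \<sigma>1"
      by (rule step.IH) (use 1 step.prems(2) inv comm in auto)
    then show ?thesis using 1 by simp
  next
    case (2 f)
    obtain fs where fs: "fss ! i = f # fs" "straight I th' fs"
      using str 2 by (auto elim: straight.cases)
    have f: "f \<in> set (fss ! i)" using fs by simp
    \<comment> \<open>Pending lists only shrink, so invariance of \<open>I\<close> and commutation
      pass on to \<open>fss[i := fs]\<close>.\<close>
    have sub: "set (fss[i := fs] ! j) \<subseteq> set (fss ! j)" if "j < length fss" for j
      using that fs by (cases "j = i") auto
    have sub': "set (concat (fss[i := fs])) \<subseteq> set (concat fss)"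
    proof
      fix g assume "g \<in> set (concat (fss[i := fs]))"
      then obtain j where "j < length fss" "g \<in> set (fss[i := fs] ! j)"
        by (auto simp: in_set_conv_nth[of _ "fss[i := fs]"])
      then show "g \<in> set (concat fss)"
        using sub[of j] nth_mem[of j fss] by fastforce
    qed
    have "list_all2 (straight I) ths' (fss[i := fs])"
      using step.prems(1) i(1,3) fs(2) by (auto simp: list_all2_conv_all_nth nth_list_update)
    then have "\<sigma>' = apply_all (concat (fss[i := fs])) \<sigma>1"
    proof (rule step.IH)
      show "\<sigma>1 \<in> I"
        using inv[of f \<sigma>] f 2 step.prems(2) nth_mem[OF i'] by fastforce
    next
      fix g \<tau> assume "g \<in> set (concat (fss[i := fs]))" "\<tau> \<in> I"
      then show "g \<tau> \<in> I" using sub' inv by blast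
    next
      fix j k g h x
      assume "j < length (fss[i := fs])" "k < length (fss[i := fs])" "j \<noteq> k"
        "g \<in> set (fss[i := fs] ! j)" "h \<in> set (fss[i := fs] ! k)"
      then show "g (h x) = h (g x)"
        using comm[of j k g h x] sub[of j] sub[of k] by auto
    qed
    also have "\<dots> = apply_all (concat fss) \<sigma>"
      using apply_all_concat_pull[OF i' fs(1)] comm[OF i' _ _ f] 2 by metis
    finally show ?thesis .
  qed
qed

lemma par_step_length: "par_step (ths, \<sigma>) (ths', \<sigma>') \<Longrightarrow> length ths' = length ths"
  by (auto elim: par_step.cases)

text \<open>Well-founded induction over \<open>par_step\<close>: \<open>par_step_progress\<close>
  supplies a next step as long as some thread is unfinished. This yields the existence half of
  \<open>par_loop_iff\<close>.\<close>

lemma par_loop_total: "\<exists>\<sigma>'. par_loop ths \<sigma> \<sigma>'"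
proof -
  have "\<exists>\<sigma>'. par_step\<^sup>*\<^sup>* c (replicate (length (fst c)) Done, \<sigma>')" for c :: "'a thread list \<times> 'a"
  proof (induction c rule: wf_induct_rule[OF par_step_wf])
    case (1 c)
    obtain ths \<sigma> where c: "c = (ths, \<sigma>)" by (cases c)
    show ?case
    proof (cases "ths = replicate (length ths) Done")
      case True
      then show ?thesis using c by auto
    next
      case False
      then obtain ths' \<sigma>1 where s: "par_step (ths, \<sigma>) (ths', \<sigma>1)"
        using par_step_progress by (metis surj_pair)
      then obtain \<sigma>' where "par_step\<^sup>*\<^sup>* (ths', \<sigma>1) (replicate (length ths') Done, \<sigma>')"
        using 1 c by fastforce
      then show ?thesis
        using s par_step_length[OF s] c by (auto intro: converse_rtranclp_into_rtranclp)
    qed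
  qed
  from this[of "(ths, \<sigma>)"] show ?thesis by (simp add: par_loop_def)
qed

text \<open>\<open>par_steps_result\<close> leaves a single candidate for the final memory, and
  \<open>par_loop_total\<close> says that some final memory is reached, so the candidate is. In the
  applications \<open>I\<close> fixes the fields that the threads read.\<close>

lemma par_loop_iff:
  assumes "\<And>i. i < n \<Longrightarrow> straight I (th i) (fs i)" and "\<sigma> \<in> I"
    and "\<And>i f \<tau>. i < n \<Longrightarrow> f \<in> set (fs i) \<Longrightarrow> \<tau> \<in> I \<Longrightarrow> f \<tau> \<in> I"
    and "\<And>i j f g x. i < n \<Longrightarrow> j < n \<Longrightarrow> i \<noteq> j \<Longrightarrow> f \<in> set (fs i) \<Longrightarrow> g \<in> set (fs j) \<Longrightarrow>
           f (g x) = g (f x)"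
  shows "par_loop (map th [0..<n]) \<sigma> \<sigma>' \<longleftrightarrow> \<sigma>' = apply_all (concat (map fs [0..<n])) \<sigma>"
proof -
  have "\<tau> = apply_all (concat (map fs [0..<n])) \<sigma>" if "par_loop (map th [0..<n]) \<sigma> \<tau>" for \<tau>
    using that unfolding par_loop_def
    by (rule par_steps_result[where I = I])
      (use assms(1,2) in \<open>auto simp: list_all2_conv_all_nth intro: assms(3,4)\<close>)
  then show ?thesis
    using par_loop_total[of "map th [0..<n]" \<sigma>] by blast
qed


section \<open>Overwriting an array\<close>

abbreviation write_all :: "(nat \<times> 'a) list \<Rightarrow> 'a list \<Rightarrow> 'a list" where
  "write_all ps \<equiv> fold (\<lambda>(q, x) a. a[q := x]) ps"

lemma length_write_all: "length (write_all ps a) = length a"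
  by (induction ps arbitrary: a) auto

text \<open>Serves to show that every key in the filled array is a value of
  \<open>MonKey\<close>.\<close>

lemma set_write_all: "set (write_all ps a) \<subseteq> set a \<union> snd ` set ps"
proof (induction ps arbitrary: a)
  case (Cons p ps)
  obtain q x where "p = (q, x)" by (cases p)
  then show ?case
    using Cons[of "a[q := x]"] set_update_subset_insert[of a q x] by auto
qed simp

text \<open>Makes the contents of a newly allocated array irrelevant once all its positions are
  written. In the induction a write to \<open>q\<close> may drop \<open>q\<close> from the pending
  positions, but then both arrays agree there.\<close>

lemma write_all_cong:
  assumes "length a = length b"
    and "\<And>q. q < length a \<Longrightarrow> q \<in> fst ` set ps \<or> a ! q = b ! q"
  shows "write_all ps a = write_all ps b"
  using assms
proof (induction ps arbitrary: a b)
  case Nil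
  then show ?case by (auto intro: nth_equalityI)
next
  case (Cons p ps)
  obtain q x where p: "p = (q, x)" by (cases p)
  have "q' \<in> fst ` set ps \<or> a[q := x] ! q' = b[q := x] ! q'" if "q' < length a" for q'
    using Cons.prems(1) Cons.prems(2)[OF that] that p by (cases "q' = q") auto
  then have "write_all ps (a[q := x]) = write_all ps (b[q := x])"
    using Cons.prems(1) by (intro Cons.IH) auto
  then show ?case using p by simp
qed


section \<open>Row pointers\<close>

lemma prefix_sums_nth: "i \<le> length ls \<Longrightarrow> prefix_sums s ls ! i = s + sum_list (take i ls)"
  by (induction ls arbitrary: s i) (auto simp: nth_Cons take_Cons split: nat.splits)

lemma prefix_sums_Suc: "i < length ls \<Longrightarrow> prefix_sums s ls ! Suc i = prefix_sums s ls ! i + ls ! i"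
  by (simp add: prefix_sums_nth take_Suc_conv_app_nth)

lemma prefix_sums_mono:
  assumes "i \<le> j" and "j \<le> length ls"
  shows "prefix_sums s ls ! i \<le> prefix_sums s ls ! j"
proof -
  have "take j ls = take i ls @ take (j - i) (drop i ls)"
    using assms(1) by (metis le_add_diff_inverse take_add)
  then show ?thesis using assms by (simp add: prefix_sums_nth)
qed

text \<open>Monotonicity puts pointer \<open>Suc i\<close> at or below pointer \<open>j\<close> when
  \<open>i < j\<close>, and symmetrically otherwise. Commutation of the writes of different rows
  rests on this.\<close>

lemma prefix_sums_disjoint:
  assumes "i < length ls" and "j < length ls" and "i \<noteq> j"
    and "prefix_sums s ls ! i \<le> q" and "q < prefix_sums s ls ! Suc i"
    and "prefix_sums s ls ! j \<le> q'" and "q' < prefix_sums s ls ! Suc j"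
  shows "q \<noteq> q'"
  using assms prefix_sums_mono[of "Suc i" j ls s] prefix_sums_mono[of "Suc j" i ls s]
  by (cases "i < j") auto

lemma prefix_sums_cover:
  assumes "q < sum_list ls"
  obtains i where "i < length ls" and "prefix_sums 0 ls ! i \<le> q" and "q < prefix_sums 0 ls ! Suc i"
proof -
  have "\<not> q < prefix_sums 0 ls ! 0" and "q < prefix_sums 0 ls ! length ls"
    using assms by (simp_all add: prefix_sums_nth)
  \<comment> \<open>The last pointer is the total, so some pointer exceeds \<open>q\<close>; the
    first one that does is not pointer 0, hence has an index of the form
    \<open>Suc i\<close>.\<close>
  then obtain i where "i < length ls" "\<not> q < prefix_sums 0 ls ! i" "q < prefix_sums 0 ls ! Suc i"
    using ex_least_nat_less[of "\<lambda>i. q < prefix_sums 0 ls ! i" "length ls"] by auto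
  then show ?thesis using that by (metis not_less)
qed


section \<open>The three loops\<close>

definition row_length :: "('v, 'p::prime_card) fpoly list \<Rightarrow> 'v row \<Rightarrow> nat" where
  "row_length gs row = card (Poly_Mapping.keys (Poly_Mapping.single (fst row) 1 * gs ! snd row))"

lemma count_loop_iff:
  "par_loop (map (count_row gs R) [0..<n]) \<sigma> \<sigma>' \<longleftrightarrow>
     \<sigma>' = \<sigma>\<lparr>ell := write_all (map (\<lambda>i. (i, row_length gs (R ! i))) [0..<n]) (ell \<sigma>)\<rparr>"
proof -
  let ?w = "\<lambda>i. ell_update (\<lambda>a. a[i := row_length gs (R ! i)])"
  have "par_loop (map (count_row gs R) [0..<n]) \<sigma> \<sigma>' \<longleftrightarrow>
      \<sigma>' = apply_all (concat (map (\<lambda>i. [?w i]) [0..<n])) \<sigma>"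
  \<comment> \<open>Count threads read nothing, so no memory field has to be kept fixed.\<close>
  proof (rule par_loop_iff[where I = UNIV])
    fix i show "straight UNIV (count_row gs R i) [?w i]"
      by (auto simp: count_row_def row_length_def Let_def split: prod.split intro: straight.intros)
  qed (auto simp: list_update_swap intro!: fbsp_mem.fold_congs)
  also have "apply_all (concat (map (\<lambda>i. [?w i]) is)) \<sigma> =
      \<sigma>\<lparr>ell := write_all (map (\<lambda>i. (i, row_length gs (R ! i))) is) (ell \<sigma>)\<rparr>" for "is"
    by (induction "is" arbitrary: \<sigma>) auto
  finally show ?thesis .
qed

section \<open>Fill loop\<close>

definition row_entries ::
  "('v mon \<Rightarrow> 'v mon \<Rightarrow> bool) \<Rightarrow> ('v mon \<Rightarrow> 'k) \<Rightarrow> 'v mon \<Rightarrow> ('v, 'p::prime_card) fpoly \<Rightarrow>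
   nat \<Rightarrow> nat \<Rightarrow> nat \<Rightarrow> (nat \<times> 'k \<times> 'p mod_ring) list" where
  "row_entries prec MonKey t g s j n =
     map (\<lambda>j. let m = desc_monomials prec g ! j in (s + j, MonKey (t + m), Poly_Mapping.lookup g m))
       [j..<j + n]"

text \<open>Position, key and coefficient are kept together, so that one list describes the writes
  to both arrays. The parameter \<open>ls\<close> replaces what the thread reads from
  \<open>ell\<close> and \<open>row_ptr\<close>.\<close>

definition fill_entries ::
  "('v mon \<Rightarrow> 'v mon \<Rightarrow> bool) \<Rightarrow> ('v mon \<Rightarrow> 'k) \<Rightarrow> ('v, 'p::prime_card) fpoly list \<Rightarrow> 'v row list \<Rightarrow>
   nat list \<Rightarrow> nat \<Rightarrow> (nat \<times> 'k \<times> 'p mod_ring) list" where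
  "fill_entries prec MonKey gs R ls i =
     row_entries prec MonKey (fst (R ! i)) (gs ! snd (R ! i)) (prefix_sums 0 ls ! i) 0 (ls ! i)"

fun entry_writes :: "nat \<times> 'k \<times> 'p::prime_card mod_ring \<Rightarrow> (('k, 'p) fbsp_mem \<Rightarrow> ('k, 'p) fbsp_mem) list" where
  "entry_writes (q, x, c) = [row_key_update (\<lambda>a. a[q := x]), row_val_update (\<lambda>a. a[q := c])]"

text \<open>The inner loop only writes, so its trace is the same under every
  \<open>I\<close>.\<close>

lemma straight_fill_from:
  "straight I (fill_from prec MonKey t g s j n)
     (concat (map entry_writes (row_entries prec MonKey t g s j n)))"
proof (induction n arbitrary: j)
  case (Suc n)
  show ?case
    using Suc[of "Suc j"]
    by (auto simp: row_entries_def Let_def upt_rec[of j "Suc (j + n)"] simp del: upt_Suc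
        intro: straight.intros)
qed (simp add: row_entries_def straight.Done)

lemma fill_entries_pos:
  "e \<in> set (fill_entries prec MonKey gs R ls i) \<Longrightarrow> i < length ls \<Longrightarrow>
     prefix_sums 0 ls ! i \<le> fst e \<and> fst e < prefix_sums 0 ls ! Suc i"
  by (auto simp: fill_entries_def row_entries_def Let_def prefix_sums_Suc)

lemma fill_loop_iff:
  fixes \<sigma> :: "('k, 'p::prime_card) fbsp_mem"
  assumes "row_ptr \<sigma> = prefix_sums 0 (ell \<sigma>)" and "length (ell \<sigma>) = length R"
  shows "par_loop (map (fill_row prec MonKey gs R) [0..<length R]) \<sigma> \<sigma>' \<longleftrightarrow>
     (let es = concat (map (fill_entries prec MonKey gs R (ell \<sigma>)) [0..<length R])
      in \<sigma>' = \<sigma>\<lparr>row_key := write_all (map (\<lambda>(q, x, c). (q, x)) es) (row_key \<sigma>),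
                 row_val := write_all (map (\<lambda>(q, x, c). (q, c)) es) (row_val \<sigma>)\<rparr>)"
proof -
  define ls where "ls = ell \<sigma>"
  \<comment> \<open>Fill threads read just \<open>row_ptr\<close> and \<open>ell\<close> and write
    neither; fixing both determines their traces in advance.\<close>
  let ?I = "{\<tau> :: ('k, 'p) fbsp_mem. row_ptr \<tau> = prefix_sums 0 ls \<and> ell \<tau> = ls}"
  let ?e = "fill_entries prec MonKey gs R ls"
  have "par_loop (map (fill_row prec MonKey gs R) [0..<length R]) \<sigma> \<sigma>' \<longleftrightarrow>
      \<sigma>' = apply_all (concat (map (\<lambda>i. concat (map entry_writes (?e i))) [0..<length R])) \<sigma>"
  proof (rule par_loop_iff[where I = ?I])
    fix i
    show "straight ?I (fill_row prec MonKey gs R i) (concat (map entry_writes (?e i)))"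
    proof -
      obtain t k where row: "R ! i = (t, k)" by fastforce
      have "straight ?I
          (Read (\<lambda>\<sigma>. fill_from prec MonKey t (gs ! k) (prefix_sums 0 ls ! i) 0 (ell \<sigma> ! i)))
          (concat (map entry_writes (?e i)))"
        unfolding fill_entries_def row
        by (rule straight.Read[OF _ straight_fill_from]) simp
      then show ?thesis
        unfolding fill_row_def Let_def row prod.case
        by (rule straight.Read[rotated]) simp
    qed
  next
    show "\<sigma> \<in> ?I" using assms by (simp add: ls_def)
  next
    fix i f \<tau>
    assume "f \<in> set (concat (map entry_writes (?e i)))" "\<tau> \<in> ?I"
    then show "f \<tau> \<in> ?I" by auto
  next
    fix i j f h and \<tau> :: "('k, 'p) fbsp_mem"
    assume ij: "i < length R" "j < length R" "i \<noteq> j"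
      and "f \<in> set (concat (map entry_writes (?e i)))" "h \<in> set (concat (map entry_writes (?e j)))"
    then obtain e e' where e: "e \<in> set (?e i)" "f \<in> set (entry_writes e)"
      and e': "e' \<in> set (?e j)" "h \<in> set (entry_writes e')"
      unfolding set_concat set_map by blast
    \<comment> \<open>Entries of different rows lie in disjoint blocks, which settles two writes to
      the same array; a key write and a value write commute as they act on different fields.\<close>
    have "fst e \<noteq> fst e'"
      using ij assms(2) fill_entries_pos[OF e(1)] fill_entries_pos[OF e'(1)]
        prefix_sums_disjoint[of i ls j 0 "fst e" "fst e'"]
      by (auto simp: ls_def)
    then show "f (h \<tau>) = h (f \<tau>)"
      using e(2) e'(2) by (cases e; cases e') (auto simp: list_update_swap)
  qed
  also have "concat (map (\<lambda>i. concat (map entry_writes (?e i))) is) =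
      concat (map entry_writes (concat (map ?e is)))" for "is"
    by (induction "is") auto
  \<comment> \<open>Key and value writes alternate in the list but act on different fields, so they
    separate into two array updates.\<close>
  also have "apply_all (concat (map entry_writes es)) \<sigma> =
      \<sigma>\<lparr>row_key := write_all (map (\<lambda>(q, x, c). (q, x)) es) (row_key \<sigma>),
         row_val := write_all (map (\<lambda>(q, x, c). (q, c)) es) (row_val \<sigma>)\<rparr>" for es
    by (induction es arbitrary: \<sigma>) auto
  finally show ?thesis by (simp add: ls_def Let_def)
qed

text \<open>The row whose block contains \<open>q\<close> writes at every offset of that block. This
  is what erases the initial contents of \<open>row_key\<close> and \<open>row_val\<close>.\<close>

lemma fill_entries_cover:
  assumes "length ls = length R" and "q < sum_list ls"
  shows "q \<in> fst ` set (concat (map (fill_entries prec MonKey gs R ls) [0..<length R]))"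
proof -
  obtain i where i: "i < length ls" "prefix_sums 0 ls ! i \<le> q" "q < prefix_sums 0 ls ! Suc i"
    using assms(2) by (rule prefix_sums_cover)
  let ?j = "q - prefix_sums 0 ls ! i"
  have "q = prefix_sums 0 ls ! i + ?j" "?j < ls ! i"
    using i by (auto simp: prefix_sums_Suc)
  then have "q \<in> fst ` set (fill_entries prec MonKey gs R ls i)"
    by (force simp: fill_entries_def row_entries_def Let_def image_image)
  moreover have "set (fill_entries prec MonKey gs R ls i) \<subseteq>
      set (concat (map (fill_entries prec MonKey gs R ls) [0..<length R]))"
    using i(1) assms(1) by auto
  ultimately show ?thesis by blast
qed

section \<open>Column assembly loop\<close>

abbreviation col_positions :: "nat list \<Rightarrow> nat \<Rightarrow> nat list" where
  "col_positions ls i \<equiv> [prefix_sums 0 ls ! i..<prefix_sums 0 ls ! Suc i]"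

text \<open>\<open>K\<close> and \<open>D\<close> freeze the two arrays that this loop reads.
  \<open>P\<close> is carried along so that the same set serves the reads of \<open>row_ptr\<close>
  in \<open>assemble_row\<close>.\<close>

lemma straight_assemble_from:
  "straight {\<tau>. row_ptr \<tau> = P \<and> row_key \<tau> = K \<and> dict_keys \<tau> = D} (assemble_from q n)
     (map (\<lambda>q. col_ind_update (\<lambda>a. a[q := dict_index D (K ! q)])) [q..<q + n])"
proof (induction n arbitrary: q)
  case (Suc n)
  show ?case (is "straight ?I _ ?fs")
  proof -
    let ?w = "\<lambda>q. col_ind_update (\<lambda>a. a[q := dict_index D (K ! q)])"
    have fs: "?fs = ?w q # map ?w [Suc q..<Suc q + n]"
      by (simp add: upt_rec[of q "Suc (q + n)"] del: upt_Suc)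
    \<comment> \<open>The trace is built from the inside out: first the write, then each enclosing
      read, whose value the invariant determines.\<close>
    have "straight ?I (Write (?w q) (assemble_from (Suc q) n)) ?fs"
      unfolding fs by (rule straight.Write[OF Suc])
    then have "straight ?I (Read (\<lambda>\<sigma>. Write (col_ind_update (\<lambda>a. a[q := dict_index (dict_keys \<sigma>) (K ! q)]))
        (assemble_from (Suc q) n))) ?fs"
      by (rule straight.Read[rotated]) simp
    then show ?thesis
      unfolding assemble_from.simps Let_def
      by (rule straight.Read[rotated]) simp
  qed
qed (simp add: straight.Done)

lemma assemble_loop_iff:
  fixes \<sigma> :: "('k, 'p::prime_card) fbsp_mem"
  assumes "row_ptr \<sigma> = prefix_sums 0 ls"
  shows "par_loop (map assemble_row [0..<length ls]) \<sigma> \<sigma>' \<longleftrightarrow>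
     \<sigma>' = \<sigma>\<lparr>col_ind := write_all (map (\<lambda>q. (q, dict_index (dict_keys \<sigma>) (row_key \<sigma> ! q)))
                (concat (map (col_positions ls) [0..<length ls]))) (col_ind \<sigma>)\<rparr>"
proof -
  define D where "D = dict_keys \<sigma>"
  define K where "K = row_key \<sigma>"
  let ?I = "{\<tau> :: ('k, 'p) fbsp_mem. row_ptr \<tau> = prefix_sums 0 ls \<and> row_key \<tau> = K \<and> dict_keys \<tau> = D}"
  let ?w = "\<lambda>q. col_ind_update (\<lambda>a. a[q := dict_index D (K ! q)]) :: ('k, 'p) fbsp_mem \<Rightarrow> _"
  have "par_loop (map assemble_row [0..<length ls]) \<sigma> \<sigma>' \<longleftrightarrow>
      \<sigma>' = apply_all (concat (map (\<lambda>i. map ?w (col_positions ls i)) [0..<length ls])) \<sigma>"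
  proof (rule par_loop_iff[where I = ?I])
    fix i assume i: "i < length ls"
    let ?q = "prefix_sums 0 ls ! i" and ?q' = "prefix_sums 0 ls ! Suc i"
    \<comment> \<open>The subtraction of naturals is not truncated, since pointers never
      decrease.\<close>
    have "?q + (?q' - ?q) = ?q'"
      using i by (simp add: prefix_sums_Suc)
    then have "straight ?I (assemble_from ?q (?q' - ?q)) (map ?w (col_positions ls i))"
      using straight_assemble_from[of "prefix_sums 0 ls" K D ?q "?q' - ?q"] by simp
    then have "straight ?I (Read (\<lambda>\<sigma>. assemble_from ?q (row_ptr \<sigma> ! Suc i - ?q)))
        (map ?w (col_positions ls i))"
      by (rule straight.Read[rotated]) simp
    then show "straight ?I (assemble_row i) (map ?w (col_positions ls i))"
      unfolding assemble_row_def Let_def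
      by (rule straight.Read[rotated]) simp
  next
    show "\<sigma> \<in> ?I" using assms by (simp add: D_def K_def)
  next
    fix i f \<tau>
    assume "f \<in> set (map ?w (col_positions ls i))" "\<tau> \<in> ?I"
    then show "f \<tau> \<in> ?I" by auto
  next
    fix i j f h and \<tau> :: "('k, 'p) fbsp_mem"
    assume ij: "i < length ls" "j < length ls" "i \<noteq> j"
      and "f \<in> set (map ?w (col_positions ls i))" "h \<in> set (map ?w (col_positions ls j))"
    then obtain q q' where q: "q \<in> set (col_positions ls i)" "f = ?w q"
      and q': "q' \<in> set (col_positions ls j)" "h = ?w q'"
      unfolding set_map by blast
    have "q \<noteq> q'"
      using ij q(1) q'(1) prefix_sums_disjoint[of i ls j 0 q q'] by auto
    then show "f (h \<tau>) = h (f \<tau>)"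
      by (simp add: q(2) q'(2) list_update_swap)
  qed
  also have "concat (map (\<lambda>i. map ?w (col_positions ls i)) is) =
      map ?w (concat (map (col_positions ls) is))" for "is"
    by (simp add: map_concat comp_def)
  also have "apply_all (map ?w qs) \<sigma> =
      \<sigma>\<lparr>col_ind := write_all (map (\<lambda>q. (q, dict_index D (K ! q))) qs) (col_ind \<sigma>)\<rparr>" for qs
    by (induction qs arbitrary: \<sigma>) auto
  finally show ?thesis by (simp add: D_def K_def)
qed

lemma col_positions_cover:
  assumes "q < sum_list ls"
  shows "q \<in> set (concat (map (col_positions ls) [0..<length ls]))"
  using assms by (rule prefix_sums_cover) force


section \<open>The dictionary\<close>

lemma sorted_wrt_remdups: "sorted_wrt P xs \<Longrightarrow> sorted_wrt P (remdups xs)"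
  by (induction xs) auto

text \<open>Sorting gives the weak order, which \<open>remdups\<close> preserves; distinctness of
  the entries makes it strict.\<close>

lemma sorted_wrt_remdups_rev_sort:
  "sorted_wrt (>) (remdups (rev (sort (xs :: 'a::linorder list))))"
proof -
  have "sorted_wrt (\<ge>) (remdups (rev (sort xs)))"
    by (rule sorted_wrt_remdups) (simp add: sorted_wrt_rev)
  moreover have "distinct (remdups (rev (sort xs)))" by simp
  ultimately show ?thesis
    by (auto simp: sorted_wrt_iff_nth_less distinct_conv_nth less_le)
qed

text \<open>Inverting \<open>MonKey\<close> entry by entry gives a list \<open>T\<close>, and
  injectivity excludes any other. It is decreasing because a strictly monotone map on a total order
  also reflects the order.\<close>

lemma dictionary_decodes_uniquely:
  fixes MonKey :: "'m \<Rightarrow> 'k::linorder"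
  assumes "totalp prec" and "inj MonKey" and mono: "\<And>u v. prec u v \<Longrightarrow> MonKey u < MonKey v"
    and "sorted_wrt (>) D" and "set D \<subseteq> range MonKey"
  obtains T where "\<And>T'. sorted_wrt (\<lambda>u v. prec v u) T' \<and> map MonKey T' = D \<longleftrightarrow> T' = T"
proof
  let ?T = "map (inv_into UNIV MonKey) D"
  have D: "map MonKey ?T = D"
    using assms(5) by (auto intro!: map_idI simp: f_inv_into_f)
  \<comment> \<open>By totality the alternatives are \<open>u = v\<close> and
    \<open>prec u v\<close>, and both contradict the order of the keys.\<close>
  have prec: "prec v u" if "MonKey v < MonKey u" for u v
  proof -
    have "u \<noteq> v" using that by (metis less_irrefl)
    moreover have "\<not> prec u v" using that mono[of u v] by (meson less_asym)
    ultimately show ?thesis using assms(1) by (metis totalpD)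
  qed
  have "sorted_wrt (\<lambda>u v. MonKey u > MonKey v) ?T"
    using assms(4) sorted_wrt_map[of "(>)" MonKey ?T] unfolding D by simp
  then have "sorted_wrt (\<lambda>u v. prec v u) ?T"
    by (rule sorted_wrt_mono_rel[rotated]) (rule prec)
  then show "sorted_wrt (\<lambda>u v. prec v u) T' \<and> map MonKey T' = D \<longleftrightarrow> T' = ?T" for T'
    using D inj_map_eq_map[OF assms(2), of T' ?T] by auto
qed

section \<open>Uniqueness and existence of the output\<close>

theorem theorem11p4:
  fixes prec :: "('v::finite) mon \<Rightarrow> 'v mon \<Rightarrow> bool"
    and MonKey :: "'v mon \<Rightarrow> 'k::linorder"
    and gs :: "('v, 'p::prime_card) fpoly list"
    and B :: "('u, 'c, 'v, 'p) batch_spec"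
    and Sel :: "('v, 'p) fpoly list \<Rightarrow> ('u, 'c, 'v, 'p) batch_spec \<Rightarrow> 'v row list set"
    and R :: "'v row list"
  assumes "term_order prec"
    and "inj MonKey"
    and "\<And>u v. prec u v \<Longrightarrow> MonKey u < MonKey v"
    and "distinct gs"
    and "finite (targets B)"
    and "finite (candidates B)"
    and "\<And>R'. R' \<in> Sel gs B \<Longrightarrow> admissible_rows gs B R'"
    and "Sel gs B = {R}"
  shows "\<exists>T plan. \<forall>T' R' plan'. fbsp_run prec MonKey Sel gs B T' R' plan' \<longleftrightarrow> T' = T \<and> R' = R \<and> plan' = plan"
proof -
  \<comment> \<open>The constants record one sequential reference computation on arrays with chosen
    fillers. The facts \<open>ell\<close>, \<open>K\<close>, \<open>V\<close> and \<open>C\<close>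
    then replace the fillers by any contents of the same length.\<close>
  define r where "r = length R"
  define ls where "ls = write_all (map (\<lambda>i. (i, row_length gs (R ! i))) [0..<r]) (replicate r 0)"
  define M where "M = sum_list ls"
  define P where "P = prefix_sums 0 ls"
  define es where "es = concat (map (fill_entries prec MonKey gs R ls) [0..<r])"
  \<comment> \<open>The filler \<open>MonKey 0\<close> lies in \<open>range MonKey\<close>, so the
    inclusion for \<open>set K\<close> below needs only a look at the written values.\<close>
  define K where "K = write_all (map (\<lambda>(q, x, c). (q, x)) es) (replicate M (MonKey 0))"
  define V where "V = write_all (map (\<lambda>(q, x, c). (q, c)) es) (replicate M 0)"
  define D where "D = remdups (rev (sort K))"
  define cols where "cols = map (\<lambda>q. (q, dict_index D (K ! q))) (concat (map (col_positions ls) [0..<r]))"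
  define C where "C = write_all cols (replicate M 0)"
  have len: "length ls = r" by (simp add: ls_def length_write_all)
  have ell: "write_all (map (\<lambda>i. (i, row_length gs (R ! i))) [0..<r]) a = ls" if "length a = r" for a
    unfolding ls_def using that by (intro write_all_cong) (auto simp: image_image)
  have cover: "q \<in> fst ` set es" if "q < M" for q
    using fill_entries_cover[of ls R q] that len by (simp add: es_def M_def r_def)
  have K: "write_all (map (\<lambda>(q, x, c). (q, x)) es) a = K" if "length a = M" for a
    unfolding K_def using that by (intro write_all_cong) (simp_all add: image_image split_beta cover)
  have V: "write_all (map (\<lambda>(q, x, c). (q, c)) es) a = V" if "length a = M" for a
    unfolding V_def using that by (intro write_all_cong) (simp_all add: image_image split_beta cover)
  have C: "write_all cols a = C" if "length a = M" for a
  proof -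
    have "q \<in> fst ` set cols" if "q < M" for q
      using col_positions_cover[of q ls] that len by (simp add: cols_def M_def image_image)
    then show ?thesis
      unfolding C_def using that by (intro write_all_cong) auto
  qed
  have "set D \<subseteq> set K" by (simp add: D_def)
  also have "\<dots> \<subseteq> range MonKey"
    unfolding K_def
    by (rule order_trans[OF set_write_all])
      (auto simp: es_def fill_entries_def row_entries_def Let_def)
  finally have range: "set D \<subseteq> range MonKey" .
  have total: "totalp prec"
    using assms(1) by (simp add: term_order_def)
  obtain T where T: "\<And>T'. sorted_wrt (\<lambda>u v. prec v u) T' \<and> map MonKey T' = D \<longleftrightarrow> T' = T"
    using dictionary_decodes_uniquely[OF total assms(2,3) _ range] sorted_wrt_remdups_rev_sort
    by (metis D_def)
  \<comment> \<open>From here on each loop is an equation for its final memory, free of the schedule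
    and of the contents of the allocated arrays.\<close>
  have count: "par_loop (map (count_row gs R) [0..<length R]) \<sigma> \<sigma>' \<longleftrightarrow> \<sigma>' = \<sigma>\<lparr>ell := ls\<rparr>"
    if "length (ell \<sigma>) = length R" for \<sigma> \<sigma>' :: "('k, 'p) fbsp_mem"
    using ell[of "ell \<sigma>"] that by (simp add: count_loop_iff r_def)
  have fill: "par_loop (map (fill_row prec MonKey gs R) [0..<length R])
        (\<sigma>\<lparr>ell := ls, row_ptr := P, row_key := ks, row_val := vs\<rparr>) \<sigma>' \<longleftrightarrow>
      \<sigma>' = \<sigma>\<lparr>ell := ls, row_ptr := P, row_key := K, row_val := V\<rparr>"
    if "length ks = M" "length vs = M" for \<sigma> \<sigma>' ks vs
    using len K[OF that(1)] V[OF that(2)] by (simp add: fill_loop_iff P_def r_def es_def)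
  have assemble: "par_loop (map assemble_row [0..<length R])
        (\<sigma>\<lparr>ell := ls, row_ptr := P, row_key := K, row_val := V, dict_keys := D, col_ind := cs\<rparr>) \<sigma>' \<longleftrightarrow>
      \<sigma>' = \<sigma>\<lparr>ell := ls, row_ptr := P, row_key := K, row_val := V, dict_keys := D, col_ind := C\<rparr>"
    if "length cs = M" for \<sigma> \<sigma>' :: "('k, 'p) fbsp_mem" and cs
    using C[OF that]
      assemble_loop_iff[of "\<sigma>\<lparr>ell := ls, row_ptr := P, row_key := K, row_val := V, dict_keys := D, col_ind := cs\<rparr>"
        ls \<sigma>'] len
    by (simp add: P_def cols_def r_def)
  have "fbsp_run prec MonKey Sel gs B T' R' plan' \<longleftrightarrow> T' = T \<and> R' = R \<and> plan' = (P, C, V, D, R)"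
    for T' R' plan'
  proof
    assume "fbsp_run prec MonKey Sel gs B T' R' plan'"
    moreover from this have R': "R' = R"
      using assms(8) by (simp add: fbsp_run_def)
    ultimately obtain \<sigma>\<^sub>0 \<sigma>\<^sub>1 \<sigma>\<^sub>2 \<sigma>\<^sub>3 \<sigma>\<^sub>4 \<sigma>\<^sub>5 :: "('k, 'p) fbsp_mem" and ks vs cs where
      s0: "length (ell \<sigma>\<^sub>0) = length R"
      and s1: "par_loop (map (count_row gs R) [0..<length R]) \<sigma>\<^sub>0 \<sigma>\<^sub>1"
      and lens: "length ks = sum_list (ell \<sigma>\<^sub>1)" "length vs = sum_list (ell \<sigma>\<^sub>1)"
        "length cs = sum_list (ell \<sigma>\<^sub>1)"
      and s2: "\<sigma>\<^sub>2 = \<sigma>\<^sub>1\<lparr>row_ptr := prefix_sums 0 (ell \<sigma>\<^sub>1), row_key := ks, row_val := vs\<rparr>"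
      and s3: "par_loop (map (fill_row prec MonKey gs R) [0..<length R]) \<sigma>\<^sub>2 \<sigma>\<^sub>3"
      and s4: "\<sigma>\<^sub>4 = \<sigma>\<^sub>3\<lparr>dict_keys := remdups (rev (sort (row_key \<sigma>\<^sub>3))), col_ind := cs\<rparr>"
      and s5: "par_loop (map assemble_row [0..<length R]) \<sigma>\<^sub>4 \<sigma>\<^sub>5"
      and T': "sorted_wrt (\<lambda>u v. prec v u) T'" "map MonKey T' = dict_keys \<sigma>\<^sub>5"
      and plan: "plan' = (row_ptr \<sigma>\<^sub>5, col_ind \<sigma>\<^sub>5, row_val \<sigma>\<^sub>5, dict_keys \<sigma>\<^sub>5, R)"
      unfolding fbsp_run_def by blast
    \<comment> \<open>The equations are substituted in the order of execution. Every field that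
      enters the plan has been overwritten, so nothing of \<open>\<sigma>\<^sub>0\<close> survives
      in the output.\<close>
    have e1: "\<sigma>\<^sub>1 = \<sigma>\<^sub>0\<lparr>ell := ls\<rparr>"
      using s1 count[OF s0] by blast
    then have lens': "length ks = M" "length vs = M" "length cs = M"
      using lens by (simp_all add: M_def)
    have "\<sigma>\<^sub>3 = \<sigma>\<^sub>0\<lparr>ell := ls, row_ptr := P, row_key := K, row_val := V\<rparr>"
      using s3 fill[OF lens'(1,2)] by (simp add: s2 e1 P_def)
    then have "\<sigma>\<^sub>5 = \<sigma>\<^sub>0\<lparr>ell := ls, row_ptr := P, row_key := K, row_val := V, dict_keys := D, col_ind := C\<rparr>"
      using s5 assemble[OF lens'(3)] by (simp add: s4 D_def)
    then show "T' = T \<and> R' = R \<and> plan' = (P, C, V, D, R)"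
      using T' T[of T'] R' plan by simp
  next
    assume eq: "T' = T \<and> R' = R \<and> plan' = (P, C, V, D, R)"
    \<comment> \<open>Conversely, one concrete run shows that this output occurs. \<open>ell\<close>
      must have one cell per row; the other initial fields are replaced before they are
      read.\<close>
    define \<sigma>\<^sub>0 :: "('k, 'p) fbsp_mem" where
      "\<sigma>\<^sub>0 = \<lparr>ell = replicate (length R) 0, row_ptr = [], row_key = [], row_val = [], dict_keys = [], col_ind = []\<rparr>"
    define ks where "ks = replicate M (MonKey 0)"
    define vs :: "'p mod_ring list" where "vs = replicate M 0"
    define cs :: "nat list" where "cs = replicate M 0"
    \<comment> \<open>The memories are written as updates of \<open>\<sigma>\<^sub>0\<close> so as
      to match \<open>count\<close>, \<open>fill\<close> and \<open>assemble\<close> literally; the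
      sequential links between them are checked in \<open>s2\<close> and \<open>s4\<close>.\<close>
    define \<sigma>\<^sub>1 where "\<sigma>\<^sub>1 = \<sigma>\<^sub>0\<lparr>ell := ls\<rparr>"
    define \<sigma>\<^sub>2 where "\<sigma>\<^sub>2 = \<sigma>\<^sub>0\<lparr>ell := ls, row_ptr := P, row_key := ks, row_val := vs\<rparr>"
    define \<sigma>\<^sub>3 where "\<sigma>\<^sub>3 = \<sigma>\<^sub>0\<lparr>ell := ls, row_ptr := P, row_key := K, row_val := V\<rparr>"
    define \<sigma>\<^sub>4 where
      "\<sigma>\<^sub>4 = \<sigma>\<^sub>0\<lparr>ell := ls, row_ptr := P, row_key := K, row_val := V, dict_keys := D, col_ind := cs\<rparr>"
    define \<sigma>\<^sub>5 where
      "\<sigma>\<^sub>5 = \<sigma>\<^sub>0\<lparr>ell := ls, row_ptr := P, row_key := K, row_val := V, dict_keys := D, col_ind := C\<rparr>"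
    have lens: "length ks = M" "length vs = M" "length cs = M"
      by (simp_all add: ks_def vs_def cs_def)
    have s0: "length (ell \<sigma>\<^sub>0) = length R" by (simp add: \<sigma>\<^sub>0_def)
    have s1: "par_loop (map (count_row gs R) [0..<length R]) \<sigma>\<^sub>0 \<sigma>\<^sub>1"
      using count[OF s0] \<sigma>\<^sub>1_def by blast
    have M: "M = sum_list (ell \<sigma>\<^sub>1)"
      by (simp add: \<sigma>\<^sub>1_def M_def)
    have s2: "\<sigma>\<^sub>2 = \<sigma>\<^sub>1\<lparr>row_ptr := prefix_sums 0 (ell \<sigma>\<^sub>1), row_key := ks, row_val := vs\<rparr>"
      by (simp add: \<sigma>\<^sub>1_def \<sigma>\<^sub>2_def P_def)
    have s3: "par_loop (map (fill_row prec MonKey gs R) [0..<length R]) \<sigma>\<^sub>2 \<sigma>\<^sub>3"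
      using fill[OF lens(1,2)] \<sigma>\<^sub>2_def \<sigma>\<^sub>3_def by blast
    have s4: "\<sigma>\<^sub>4 = \<sigma>\<^sub>3\<lparr>dict_keys := remdups (rev (sort (row_key \<sigma>\<^sub>3))), col_ind := cs\<rparr>"
      by (simp add: \<sigma>\<^sub>3_def \<sigma>\<^sub>4_def D_def)
    have s5: "par_loop (map assemble_row [0..<length R]) \<sigma>\<^sub>4 \<sigma>\<^sub>5"
      using assemble[OF lens(3)] \<sigma>\<^sub>4_def \<sigma>\<^sub>5_def by blast
    have T5: "sorted_wrt (\<lambda>u v. prec v u) T" "map MonKey T = dict_keys \<sigma>\<^sub>5"
      using T[of T] by (simp_all add: \<sigma>\<^sub>5_def)
    have plan: "(P, C, V, D, R) = (row_ptr \<sigma>\<^sub>5, col_ind \<sigma>\<^sub>5, row_val \<sigma>\<^sub>5, dict_keys \<sigma>\<^sub>5, R)"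
      by (simp add: \<sigma>\<^sub>5_def)
    have "R \<in> Sel gs B" using assms(8) by simp
    then have "fbsp_run prec MonKey Sel gs B T R (P, C, V, D, R)"
      unfolding fbsp_run_def using s0 s1 M lens s2 s3 s4 s5 T5 plan by blast
    then show "fbsp_run prec MonKey Sel gs B T' R' plan'" using eq by simp
  qed
  then show ?thesis by blast
qed

end
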